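(* There is a polynomial-time algorithm which, given a finite simple undirected graph $G=(V,E)$, outputs a total cover $S$ of $G$ with $|S|\le 2\,\alpha_2(G)$. That is, the minimum total cover problem admits a $2$-approximation algorithm.
   Context: For a graph $G=(V,E)$, a set $D\subseteq V\cup E$ is a total cover of $G$ if every element of $(V\cup E)\setminus D$ is adjacent or incident to some element of $D$ (two vertices are adjacent if joined by an edge, two edges are adjacent if they share an endpoint, and a vertex and an edge are incident if the vertex is an endpoint of the edge). $\alpha_2(G)$ denotes the minimum size of a total cover of $G$. The minimum total cover problem asks, given $G$, for a total cover of minimum size. *)

theory Defs
  imports Main "HOL-Computational_Algebra.Polynomial"
begin

section \<open>Total covers\<close>

definition simple_graph :: "'a set \<Rightarrow> 'a set set \<Rightarrow> bool" where
  "simple_graph V E \<longleftrightarrow> finite V \<and> (\<forall>e\<in>E. e \<subseteq> V \<and> card e = 2)"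

text \<open>Vertices and edges are the two summands of \<^typ>\<open>'a + 'a set\<close>, so
  \<open>V <+> E\<close> is the (disjoint) union of the vertex set and the edge set.\<close>

fun adjacent_or_incident :: "'a set set \<Rightarrow> 'a + 'a set \<Rightarrow> 'a + 'a set \<Rightarrow> bool" where
  "adjacent_or_incident E (Inl u) (Inl v) \<longleftrightarrow> {u, v} \<in> E"
| "adjacent_or_incident E (Inr e) (Inr f) \<longleftrightarrow> e \<noteq> f \<and> e \<inter> f \<noteq> {}"
| "adjacent_or_incident E (Inl v) (Inr e) \<longleftrightarrow> v \<in> e"
| "adjacent_or_incident E (Inr e) (Inl v) \<longleftrightarrow> v \<in> e"

definition total_cover :: "'a set \<Rightarrow> 'a set set \<Rightarrow> ('a + 'a set) set \<Rightarrow> bool" where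
  "total_cover V E D \<longleftrightarrow>
     D \<subseteq> V <+> E \<and> (\<forall>x \<in> (V <+> E) - D. \<exists>y\<in>D. adjacent_or_incident E x y)"

definition alpha2 :: "'a set \<Rightarrow> 'a set set \<Rightarrow> nat" where
  "alpha2 V E = Min (card ` {D. total_cover V E D})"

section \<open>Model of computation\<close>

text \<open>Structured programs for a random access machine over the natural numbers. The memory
  consists of arrays addressed by a name and an index (a scalar variable is cell \<open>0\<close> of
  its array). Every operation costs one time unit. The only arithmetic operations are
  addition and truncated subtraction, so that a program running for \<open>t\<close> steps can only
  create numbers of \<open>O(t)\<close> bits more than its input and constants; hence polynomial time
  in this uniform cost measure is the same as polynomial time on a Turing machine. With
  multiplication at unit cost this would fail.\<close>

type_synonym vname = string
type_synonym state = "vname \<Rightarrow> nat \<Rightarrow> nat"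

datatype aexp =
    Const nat
  | Read vname aexp
  | Plus aexp aexp
  | Minus aexp aexp

datatype bexp =
    Less aexp aexp
  | Eq aexp aexp
  | Not bexp
  | And bexp bexp

datatype com =
    Skip
  | Assign vname aexp aexp  \<comment> \<open>\<open>Assign x i a\<close> is \<open>x[i] := a\<close>\<close>
  | Seq com com
  | Cond bexp com com
  | While bexp com

fun aval :: "aexp \<Rightarrow> state \<Rightarrow> nat" where
  "aval (Const k) s = k"
| "aval (Read x i) s = s x (aval i s)"
| "aval (Plus a b) s = aval a s + aval b s"
| "aval (Minus a b) s = aval a s - aval b s"

fun bval :: "bexp \<Rightarrow> state \<Rightarrow> bool" where
  "bval (Less a b) s \<longleftrightarrow> aval a s < aval b s"
| "bval (Eq a b) s \<longleftrightarrow> aval a s = aval b s"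
| "bval (Not b) s \<longleftrightarrow> \<not> bval b s"
| "bval (And b c) s \<longleftrightarrow> bval b s \<and> bval c s"

fun atime :: "aexp \<Rightarrow> nat" where
  "atime (Const k) = 1"
| "atime (Read x i) = 1 + atime i"
| "atime (Plus a b) = 1 + atime a + atime b"
| "atime (Minus a b) = 1 + atime a + atime b"

fun btime :: "bexp \<Rightarrow> nat" where
  "btime (Less a b) = 1 + atime a + atime b"
| "btime (Eq a b) = 1 + atime a + atime b"
| "btime (Not b) = 1 + btime b"
| "btime (And b c) = 1 + btime b + btime c"

text \<open>\<open>exec c s t s'\<close>: started in state \<open>s\<close>, the program \<open>c\<close> halts in state \<open>s'\<close> after
  exactly \<open>t\<close> time units.\<close>

inductive exec :: "com \<Rightarrow> state \<Rightarrow> nat \<Rightarrow> state \<Rightarrow> bool" where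
  Skip: "exec Skip s 1 s"
| Assign: "exec (Assign x i a) s (1 + atime i + atime a)
             (s(x := (s x)(aval i s := aval a s)))"
| Seq: "exec c1 s1 t1 s2 \<Longrightarrow> exec c2 s2 t2 s3 \<Longrightarrow> exec (Seq c1 c2) s1 (t1 + t2) s3"
| CondTrue: "bval b s \<Longrightarrow> exec c1 s t s' \<Longrightarrow> exec (Cond b c1 c2) s (1 + btime b + t) s'"
| CondFalse: "\<not> bval b s \<Longrightarrow> exec c2 s t s' \<Longrightarrow> exec (Cond b c1 c2) s (1 + btime b + t) s'"
| WhileFalse: "\<not> bval b s \<Longrightarrow> exec (While b c) s (1 + btime b) s"
| WhileTrue: "bval b s1 \<Longrightarrow> exec c s1 t1 s2 \<Longrightarrow> exec (While b c) s2 t2 s3 \<Longrightarrow>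
    exec (While b c) s1 (1 + btime b + t1 + t2) s3"

text \<open>Input and output are lists of numbers, stored with their length in front; all other
  cells are initially \<open>0\<close>.\<close>

definition input_state :: "nat list \<Rightarrow> state" where
  "input_state xs = (\<lambda>x i. 0)(''input'' :=
     (\<lambda>i. if i < Suc (length xs) then (length xs # xs) ! i else 0))"

definition output_list :: "state \<Rightarrow> nat list" where
  "output_list s = map (s ''output'') [1..<Suc (s ''output'' 0)]"

section \<open>Encodings\<close>

definition flatten :: "(nat \<times> nat) list \<Rightarrow> nat list" where
  "flatten ps = concat (map (\<lambda>(u, v). [u, v]) ps)"

text \<open>A graph with vertices \<open>0, \<dots>, n - 1\<close> is presented as \<open>n\<close> followed by the
  endpoints of its edges, each edge listed once, in any order and orientation.\<close>

definition encodes_graph :: "nat list \<Rightarrow> nat set \<Rightarrow> nat set set \<Rightarrow> bool" where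
  "encodes_graph xs V E \<longleftrightarrow>
     (\<exists>n es. xs = n # flatten es \<and> V = {..<n} \<and>
        distinct (map (\<lambda>(u, v). {u, v}) es) \<and> E = set (map (\<lambda>(u, v). {u, v}) es))"

text \<open>A set of vertices and edges is presented as a list of pairs: \<open>(v, v)\<close> stands for the
  vertex \<open>v\<close>, and \<open>(u, v)\<close> with \<open>u \<noteq> v\<close> for the edge \<open>{u, v}\<close>.\<close>

definition element_of_pair :: "nat \<times> nat \<Rightarrow> nat + nat set" where
  "element_of_pair = (\<lambda>(u, v). if u = v then Inl u else Inr {u, v})"

definition encodes_elements :: "nat list \<Rightarrow> (nat + nat set) set \<Rightarrow> bool" where
  "encodes_elements ys S \<longleftrightarrow> (\<exists>ps. ys = flatten ps \<and> S = element_of_pair ` set ps)"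

end

theory Submission
  imports Defs
begin

text \<open>A matching is enlarged until it has no augmenting path with at most five edges; the search
  tries all triples of arcs. Its unmatched vertices are then independent. From every unmatched vertex
  \<open>w\<close> that has a neighbour \<open>u\<close> whose mate is not adjacent to \<open>w\<close>, one such
  \<open>u\<close> is selected. The cover contains the selected vertices, the matching edges without a
  selected endpoint and the unmatched vertices without a selected neighbour. An element not
  covered by these would give an augmenting path with three or five edges.

  Given an arbitrary total cover \<open>D\<close>, let \<open>X\<close> consist of the vertices in \<open>D\<close>
  and the endpoints of the edges in \<open>D\<close>, so \<open>|X| \<le> 2 |D|\<close>. Then \<open>X\<close> is a
  vertex cover that contains all isolated vertices, so it has a vertex on every matching edge. An
  unmatched vertex that was put into the cover is isolated or forms a triangle with a matching edge,
  these triangles are disjoint, and \<open>X\<close> has two vertices in each of them. Hence \<open>X\<close>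
  is at least as large as the computed cover.\<close>

section \<open>Matchings without short augmenting paths\<close>

definition adj :: "'a set set \<Rightarrow> 'a \<Rightarrow> 'a \<Rightarrow> bool" where
  "adj E u v \<longleftrightarrow> {u, v} \<in> E"

text \<open>A matching is encoded as an involution on \<open>V\<close> whose fixed points are the
  unmatched vertices.\<close>

definition matching :: "'a set \<Rightarrow> 'a set set \<Rightarrow> ('a \<Rightarrow> 'a) \<Rightarrow> bool" where
  "matching V E m \<longleftrightarrow> (\<forall>x\<in>V. m x \<in> V \<and> m (m x) = x \<and> (m x = x \<or> adj E x (m x)))"

text \<open>With edges \<open>w u\<close>, \<open>v v'\<close> and \<open>u' w'\<close>, one walk
  \<open>w u v v' u' w'\<close> covers three path lengths: five edges if all vertices differ; three
  if \<open>v' = u\<close> and \<open>u' = v\<close>, the middle arc retracing the matching edge;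
  one in the last disjunct, where the walk reads \<open>w w' w' w w w'\<close>.\<close>

definition augmenting :: "('a \<Rightarrow> 'a) \<Rightarrow> 'a \<Rightarrow> 'a \<Rightarrow> 'a \<Rightarrow> 'a \<Rightarrow> 'a \<Rightarrow> 'a \<Rightarrow> bool" where
  "augmenting m w u v v' u' w' \<longleftrightarrow>
     m w = w \<and> m w' = w' \<and> w \<noteq> w' \<and> m u = v \<and> m v' = u' \<and>
     (u \<noteq> v \<and> v' \<noteq> u' \<or> u = w' \<and> v' = w)"

text \<open>The middle pair is written first, so that in the three-edge case the later updates at
  \<open>u\<close> and \<open>u'\<close> override it.\<close>

definition augment :: "('a \<Rightarrow> 'a) \<Rightarrow> 'a \<Rightarrow> 'a \<Rightarrow> 'a \<Rightarrow> 'a \<Rightarrow> 'a \<Rightarrow> 'a \<Rightarrow> ('a \<Rightarrow> 'a)" where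
  "augment m w u v v' u' w' =
     m(v := v', v' := v, w := u, u := w, u' := w', w' := u')"

definition matched_count :: "'a set \<Rightarrow> ('a \<Rightarrow> 'a) \<Rightarrow> nat" where
  "matched_count V m = card {x \<in> V. m x \<noteq> x}"

definition locally_maximum :: "'a set set \<Rightarrow> ('a \<Rightarrow> 'a) \<Rightarrow> bool" where
  "locally_maximum E m \<longleftrightarrow>
     (\<forall>w u v v' u' w'. adj E w u \<longrightarrow> adj E v v' \<longrightarrow> adj E u' w' \<longrightarrow> \<not> augmenting m w u v v' u' w')"

lemma adj_sym: "adj E u v \<longleftrightarrow> adj E v u"
  by (simp add: adj_def insert_commute)

lemma adj_in:
  assumes "simple_graph V E" "adj E u v"
  shows "u \<in> V" "v \<in> V" "u \<noteq> v"
  using assms by (auto simp: simple_graph_def adj_def)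

lemma edge_adj:
  assumes "simple_graph V E" "e \<in> E"
  obtains u v where "e = {u, v}" "adj E u v"
  using assms by (auto simp: simple_graph_def adj_def card_2_iff)

text \<open>Off the walk nothing changes, because its vertex set is closed under the involution
  \<open>m\<close>. On the walk only three patterns of coinciding vertices are possible.\<close>

lemma matching_augment:
  assumes "simple_graph V E" and m: "matching V E m"
    and a: "adj E w u" "adj E v v'" "adj E u' w'" and aug: "augmenting m w u v v' u' w'"
  shows "matching V E (augment m w u v v' u' w')"
proof -
  note i = adj_in[OF assms(1) a(1)] adj_in[OF assms(1) a(2)] adj_in[OF assms(1) a(3)]
  have s: "adj E u w" "adj E v' v" "adj E w' u'" using a adj_sym by metis+
  have mm: "\<And>x. x \<in> V \<Longrightarrow> m (m x) = x \<and> m x \<in> V \<and> (m x = x \<or> adj E x (m x))"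
    using m by (auto simp: matching_def)
  have g: "m v = u" "m u' = v'" using mm i aug by (auto simp: augmenting_def)
  show ?thesis
    unfolding matching_def
  proof
    fix x assume x: "x \<in> V"
    show "augment m w u v v' u' w' x \<in> V \<and>
      augment m w u v v' u' w' (augment m w u v v' u' w' x) = x \<and>
      (augment m w u v v' u' w' x = x \<or> adj E x (augment m w u v v' u' w' x))"
    proof (cases "x \<in> {w, u, v, v', u', w'}")
      case True
      have eqs: "m w = w" "m w' = w'" "w \<noteq> w'" "m u = v" "m v' = u'"
        using aug by (auto simp: augmenting_def)
      consider (edge) "u = w'" "v' = w" "v = w'" "u' = w"
        | (short) "v' = u" "u' = v" "distinct [w, u, v, w']"
        | (long) "distinct [w, u, v, v', u', w']"
      proof (cases "u = w' \<and> v' = w")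
        case True
        then show ?thesis using eqs edge by metis
      next
        case False
        then have ne: "u \<noteq> v" "v' \<noteq> u'" using aug unfolding augmenting_def by blast+
        have ends: "w \<noteq> u" "w \<noteq> v" "w \<noteq> v'" "w \<noteq> u'"
          "w' \<noteq> u" "w' \<noteq> v" "w' \<noteq> v'" "w' \<noteq> u'"
          using eqs g ne by metis+
        show ?thesis
        proof (cases "v' = u")
          case True
          then show ?thesis using eqs(3,4,5) short ends ne by simp
        next
          case False
          \<comment> \<open>\<open>u' = v\<close> would give \<open>v' = u\<close>, and
            \<open>u' = u\<close> would give \<open>v' = v\<close>.\<close>
          then have "u' \<noteq> v" "u' \<noteq> u" using eqs g i(6) by metis+
          then show ?thesis using long ends ne eqs(3) False i(6) by simp
        qed
      qed
      then show ?thesis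
      proof cases
        case edge
        then show ?thesis using True a s i(1,2,4,5,7,8) by (auto simp: augment_def)
      next
        case short
        then show ?thesis using True a s i(1,2,4,5,7,8) by (auto simp: augment_def)
      next
        case long
        then show ?thesis using True a s i(1,2,4,5,7,8) by (auto simp: augment_def)
      qed
    next
      case False
      then have "m x \<notin> {w, u, v, v', u', w'}"
        using mm[OF x] aug g by (auto simp: augmenting_def)
      then show ?thesis using False mm[OF x] by (simp add: augment_def)
    qed
  qed
qed

lemma matched_count_augment:
  assumes "simple_graph V E" and m: "matching V E m"
    and a: "adj E w u" "adj E v v'" "adj E u' w'" and aug: "augmenting m w u v v' u' w'"
  shows "matched_count V m < matched_count V (augment m w u v v' u' w')"
  unfolding matched_count_def
proof (rule psubset_card_mono)
  note i = adj_in[OF assms(1) a(1)] adj_in[OF assms(1) a(2)] adj_in[OF assms(1) a(3)]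
  let ?m = "augment m w u v v' u' w'"
  show "finite {x \<in> V. ?m x \<noteq> x}" using assms(1) by (auto simp: simple_graph_def)
  have "?m w \<noteq> w"
    using i aug by (auto simp: augment_def augmenting_def)
  moreover have "?m x \<noteq> x" if "m x \<noteq> x" for x
    using i that by (auto simp: augment_def)
  ultimately show "{x \<in> V. m x \<noteq> x} \<subset> {x \<in> V. ?m x \<noteq> x}"
    using i aug by (auto simp: augmenting_def)
qed

locale locally_maximum_matching =
  fixes V :: "'a set" and E :: "'a set set" and m :: "'a \<Rightarrow> 'a"
  assumes graph: "simple_graph V E"
    and matching: "matching V E m"
    and locally_maximum: "locally_maximum E m"
begin

lemma mate: "x \<in> V \<Longrightarrow> m x \<in> V" "x \<in> V \<Longrightarrow> m (m x) = x"
  "x \<in> V \<Longrightarrow> m x \<noteq> x \<Longrightarrow> adj E x (m x)"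
  using matching by (auto simp: matching_def)

lemma no_augmenting_path_1:
  assumes "adj E w u" "m w = w"
  shows "m u \<noteq> u"
proof
  assume "m u = u"
  then have "augmenting m w u u w w u" using assms adj_in[OF graph assms(1)]
    by (auto simp: augmenting_def)
  then show False using assms locally_maximum adj_sym[of E w u] unfolding locally_maximum_def by blast
qed

text \<open>If both ends of a matching edge have unmatched neighbours, these are one and the same
  vertex, which forms a triangle with the edge.\<close>

lemma no_augmenting_path_3:
  assumes "adj E w u" "m w = w" "adj E (m u) w'" "m w' = w'"
  shows "w' = w"
proof (rule ccontr)
  assume "w' \<noteq> w"
  have u: "u \<in> V" "m u \<noteq> u"
    using adj_in[OF graph assms(1)] no_augmenting_path_1[OF assms(1,2)] by auto
  then have "augmenting m w u (m u) u (m u) w'"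
    using assms \<open>w' \<noteq> w\<close> by (auto simp: augmenting_def)
  moreover have "adj E (m u) u" using mate(3)[OF u] adj_sym by metis
  ultimately show False using assms locally_maximum unfolding locally_maximum_def by blast
qed

text \<open>\<open>v'\<close> may equal \<open>u\<close>; the walk then collapses to the three-edge
  form.\<close>

lemma no_augmenting_path_5:
  assumes "adj E w u" "m w = w" "adj E (m u) v'" "adj E (m v') w'" "m w' = w'"
  shows "w' = w"
proof (rule ccontr)
  assume "w' \<noteq> w"
  have "m u \<noteq> u" using no_augmenting_path_1[OF assms(1,2)] .
  moreover have "m v' \<noteq> v'"
    using no_augmenting_path_1[of w' "m v'"] assms(4,5) adj_sym by metis
  ultimately have "augmenting m w u (m u) v' (m v') w'"
    using assms \<open>w' \<noteq> w\<close> by (auto simp: augmenting_def)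
  then show False using assms locally_maximum unfolding locally_maximum_def by blast
qed

end

section \<open>The total cover of a matching\<close>

text \<open>A hub of an unmatched vertex \<open>w\<close> is a neighbour \<open>u\<close> of \<open>w\<close> whose mate is not
  adjacent to \<open>w\<close>. The function \<open>c\<close> sends an unmatched vertex to its selected hub, if
  there is one, and the mate of a selected hub to that hub; all other vertices are fixed. The set
  \<open>I\<close> consists of the arcs that have been searched for hubs.\<close>

definition hub_selection ::
    "'a set \<Rightarrow> 'a set set \<Rightarrow> ('a \<Rightarrow> 'a) \<Rightarrow> ('a \<times> 'a) set \<Rightarrow> ('a \<Rightarrow> 'a) \<Rightarrow> bool" where
  "hub_selection V E m I c \<longleftrightarrow>
     (\<forall>x\<in>V.
        (m x = x \<longrightarrow>
           c x = x \<and> (\<forall>u. (x, u) \<in> I \<longrightarrow> adj E x (m u)) \<or>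
           adj E x (c x) \<and> \<not> adj E x (m (c x)) \<and> c (m (c x)) = c x) \<and>
        (m x \<noteq> x \<longrightarrow> c x = x \<or> c x = m x \<and> (\<exists>w\<in>V. m w = w \<and> c w = m x)))"

context locally_maximum_matching
begin

lemma hub_selection_skip:
  assumes "hub_selection V E m I c" "w \<in> V" "m w = w \<Longrightarrow> c w = w \<Longrightarrow> adj E w (m u)"
  shows "hub_selection V E m (insert (w, u) I) c"
  using assms adj_in[OF graph] unfolding hub_selection_def by (auto 0 4)

text \<open>Only the cells \<open>w\<close> and \<open>m u\<close> change. The first is unmatched
  and so not the mate of a hub; the second is the mate of a hub \<open>c x\<close> only if
  \<open>c x = u\<close>, and then the new value is the required one.\<close>

lemma hub_selection_select:
  assumes h: "hub_selection V E m I c" and w: "m w = w" "c w = w"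
    and u: "adj E w u" "\<not> adj E w (m u)"
  shows "hub_selection V E m (insert (w, u) I) (c(w := u, m u := u))"
  unfolding hub_selection_def
proof (intro ballI conjI impI)
  have wu: "w \<in> V" "u \<in> V" "w \<noteq> u" using adj_in[OF graph u(1)] by auto
  have mu: "m u \<noteq> u" using no_augmenting_path_1[OF u(1) w(1)] .
  have muw: "m u \<noteq> w" using mate wu w mu by metis
  let ?c = "c(w := u, m u := u)"
  fix x assume x: "x \<in> V"
  {
    assume mx: "m x = x"
    have xmu: "x \<noteq> m u" using mx mate wu mu by metis
    show "?c x = x \<and> (\<forall>u'. (x, u') \<in> insert (w, u) I \<longrightarrow> adj E x (m u')) \<or>
        adj E x (?c x) \<and> \<not> adj E x (m (?c x)) \<and> ?c (m (?c x)) = ?c x"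
    proof (cases "x = w")
      case True
      then show ?thesis using u muw by simp
    next
      case False
      consider "c x = x" "\<forall>u. (x, u) \<in> I \<longrightarrow> adj E x (m u)"
        | "adj E x (c x)" "\<not> adj E x (m (c x))" "c (m (c x)) = c x"
        using h x mx unfolding hub_selection_def by blast
      then show ?thesis
      proof cases
        case 1
        then show ?thesis using False xmu by auto
      next
        case 2
        have cx: "c x \<in> V" "m (c x) \<noteq> c x"
          using adj_in[OF graph 2(1)] no_augmenting_path_1[OF 2(1) mx] by auto
        then have "m (c x) \<noteq> w" using mate w by metis
        moreover have "c x = u" if "m (c x) = m u" using that cx mate wu by metis
        ultimately show ?thesis using 2 False xmu by auto
      qed
    qed
  next
    assume mx: "m x \<noteq> x"
    show "?c x = x \<or> ?c x = m x \<and> (\<exists>w'\<in>V. m w' = w' \<and> ?c w' = m x)"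
    proof (cases "x = m u")
      case True
      then show ?thesis using wu w mate muw by auto
    next
      case False
      have "x \<noteq> w" using mx w by auto
      \<comment> \<open>\<open>w\<close> had not been sent to a hub and \<open>m u\<close> is
        matched, so neither changed cell served as the witness \<open>w'\<close>.\<close>
      moreover have "?c w' = m x" if "w' \<in> V" "m w' = w'" "c w' = m x" for w'
      proof -
        have "w' \<noteq> w" using that w mx mate x by metis
        moreover have "w' \<noteq> m u" using that mate wu mu by metis
        ultimately show ?thesis using that by simp
      qed
      moreover have "c x = x \<or> c x = m x \<and> (\<exists>w'\<in>V. m w' = w' \<and> c w' = m x)"
        using h x mx unfolding hub_selection_def by blast
      ultimately show ?thesis using False by (metis fun_upd_other)
    qed
  }
qed

end

definition cover_element :: "'a \<Rightarrow> 'a \<Rightarrow> 'a + 'a set" where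
  "cover_element u v = (if u = v then Inl u else Inr {u, v})"

locale selected_hubs = locally_maximum_matching +
  fixes c :: "'a \<Rightarrow> 'a"
  assumes hub_selection: "hub_selection V E m {(x, y). adj E x y} c"
begin

text \<open>The pair names the matching edge at \<open>x\<close> if neither end is selected,
  otherwise its selected end; for an unmatched \<open>x\<close> it names the selected hub, or
  \<open>x\<close> itself if there is none.\<close>

definition element_at :: "'a \<Rightarrow> 'a + 'a set" where
  "element_at x = cover_element (c x) (c (m x))"

definition cover :: "('a + 'a set) set" where
  "cover = element_at ` V"

lemma unmatched_cases:
  assumes "x \<in> V" "m x = x"
  obtains (self) "c x = x" "\<And>u. adj E x u \<Longrightarrow> adj E x (m u)"
    | (hub) "adj E x (c x)" "\<not> adj E x (m (c x))" "c (m (c x)) = c x"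
  using hub_selection assms unfolding hub_selection_def by blast

lemma matched_cases:
  assumes "x \<in> V" "m x \<noteq> x"
  obtains (self) "c x = x"
    | (hub) w where "c x = m x" "w \<in> V" "m w = w" "c w = m x" "adj E w (m x)" "\<not> adj E w x"
proof -
  consider "c x = x" | w where "c x = m x" "w \<in> V" "m w = w" "c w = m x"
    using hub_selection assms unfolding hub_selection_def by blast
  then show ?thesis
  proof cases
    case 2
    have "m x \<noteq> w" using assms 2 mate by metis
    from 2(2,3) show ?thesis
    proof (cases rule: unmatched_cases)
      case self
      then show ?thesis using 2 \<open>m x \<noteq> w\<close> by simp
    next
      case hub
      then show ?thesis using 2 that(2) assms mate by metis
    qed
  qed (use that in blast)
qed

text \<open>Were both ends of a matching edge selected, the unmatched vertices behind them would
  coincide, as there is no three-edge augmenting path. But the mate of a hub selected by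
  \<open>w\<close> is not adjacent to \<open>w\<close>.\<close>

lemma c_mate_of_selected:
  assumes "x \<in> V" "m x \<noteq> x" "c x = m x"
  shows "c (m x) = m x"
proof -
  from assms(1,2) obtain w where w: "m w = w" "c w = m x" "adj E w (m x)" "\<not> adj E w x"
    by (cases rule: matched_cases) (use assms in auto)
  have "m x \<in> V" "m (m x) \<noteq> m x" using assms mate by auto
  then show ?thesis
  proof (cases rule: matched_cases)
    case (hub w')
    then have "adj E w' x" "m w' = w'" using assms mate by auto
    moreover have "m (m x) = x" using assms mate by auto
    ultimately have "w' = w" using no_augmenting_path_3[of w "m x" w'] w adj_sym by metis
    then show ?thesis using w \<open>adj E w' x\<close> by simp
  qed
qed

lemma element_at_mate: "x \<in> V \<Longrightarrow> element_at (m x) = element_at x"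
  using mate by (auto simp: element_at_def cover_element_def insert_commute)

lemma element_at_cases:
  assumes "x \<in> V" "m x \<noteq> x"
  obtains (edge) "c x = x" "c (m x) = m x" "element_at x = Inr {x, m x}"
    | (self) w where "element_at x = Inl x" "w \<in> V" "m w = w" "c w = x" "adj E w x" "\<not> adj E w (m x)"
    | (other) w where "element_at x = Inl (m x)" "w \<in> V" "m w = w" "c w = m x" "adj E w (m x)" "\<not> adj E w x"
  using assms(1,2)
proof (cases rule: matched_cases)
  case c: self
  have m: "m x \<in> V" "m (m x) \<noteq> m x" using assms mate by auto
  then show ?thesis
  proof (cases rule: matched_cases)
    case self
    then show ?thesis using c edge assms by (simp add: element_at_def cover_element_def)
  next
    case (hub w)
    then show ?thesis using c that(2)[of w] assms mate(2)
      by (simp add: element_at_def cover_element_def)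
  qed
next
  case (hub w)
  then show ?thesis using that(3)[of w] c_mate_of_selected assms
    by (simp add: element_at_def cover_element_def)
qed

lemma element_at_unmatched:
  assumes "x \<in> V" "m x = x"
  shows "element_at x = Inl (c x)"
  using assms by (simp add: element_at_def cover_element_def)

text \<open>The critical case is that the mate of \<open>x\<close> is the selected hub of some
  \<open>w\<close>. For unmatched \<open>y\<close>, the path \<open>w, m x, x, y\<close> is
  augmenting unless \<open>y = w\<close>, which the choice of the hub forbids.\<close>

lemma edge_dominated:
  assumes xy: "adj E x y" and x: "m x \<noteq> x" and notin: "Inr {x, y} \<notin> cover"
  shows "\<exists>d\<in>cover. adjacent_or_incident E (Inr {x, y}) d"
proof -
  have V: "x \<in> V" "y \<in> V" "x \<noteq> y" using adj_in[OF graph xy] by auto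
  have in_cover: "element_at z \<in> cover" if "z \<in> V" for z using that by (simp add: cover_def)
  note ex = in_cover[OF V(1)] and ey = in_cover[OF V(2)]
  from V(1) x show ?thesis
  proof (cases rule: element_at_cases)
    case edge
    then have "y \<noteq> m x" using notin ex by auto
    then show ?thesis using edge ex V by (intro bexI[of _ "Inr {x, m x}"]) (auto simp: doubleton_eq_iff)
  next
    case self
    then show ?thesis using ex by (intro bexI[of _ "Inl x"]) auto
  next
    case w: (other w)
    show ?thesis
    proof (cases "y = m x")
      case True
      then show ?thesis using w ex by (intro bexI[of _ "Inl (m x)"]) auto
    next
      case False
      have mmx: "adj E (m (m x)) y" using mate(2) V xy by simp
      have "m y \<noteq> y"
      proof
        assume "m y = y"
        then have "y = w" using no_augmenting_path_3[OF w(5,3) mmx] by simp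
        then show False using w(6) xy adj_sym by metis
      qed
      with V(2) show ?thesis
      proof (cases rule: element_at_cases)
        case edge
        then show ?thesis using V False ey mate(2)[of y]
          by (intro bexI[of _ "Inr {y, m y}"]) (auto simp: doubleton_eq_iff)
      next
        case self
        then show ?thesis using ey by (intro bexI[of _ "Inl y"]) auto
      next
        case w': (other w')
        \<comment> \<open>The walk \<open>w, m x, x, y, m y, w'\<close> has five edges, so
          \<open>w' = w\<close>; as \<open>w\<close> has one selected hub,
          \<open>m x = m y\<close>.\<close>
        have "w' = w" using no_augmenting_path_5[OF w(5,3) mmx] w' adj_sym by metis
        then have "x = y" using w w' mate(2) V by metis
        then show ?thesis using V by simp
      qed
    qed
  qed
qed

text \<open>The element at a vertex is that vertex or dominates it. Unmatched vertices are
  independent, so every edge has a matched endpoint and \<open>edge_dominated\<close>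
  applies.\<close>

lemma total_cover_cover: "total_cover V E cover"
  unfolding total_cover_def
proof (intro conjI ballI)
  have in_cover: "element_at z \<in> cover" if "z \<in> V" for z using that by (simp add: cover_def)
  show "cover \<subseteq> V <+> E"
  proof
    fix s assume "s \<in> cover"
    then obtain x where x: "x \<in> V" and s: "s = element_at x" by (auto simp: cover_def)
    show "s \<in> V <+> E"
    proof (cases "m x = x")
      case True
      with x have "c x \<in> V"
        by (cases rule: unmatched_cases) (use x adj_in[OF graph] in auto)
      then show ?thesis using element_at_unmatched[OF x True] s by auto
    next
      case False
      with x show ?thesis
        by (cases rule: element_at_cases) (use x s mate False in \<open>auto simp: adj_def\<close>)
    qed
  qed
  fix z assume z: "z \<in> (V <+> E) - cover"
  then consider (vertex) x where "x \<in> V" "z = Inl x" | (edge) e where "e \<in> E" "z = Inr e"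
    by auto
  then show "\<exists>y\<in>cover. adjacent_or_incident E z y"
  proof cases
    case (vertex x)
    show ?thesis
    proof (cases "m x = x")
      case True
      have ex: "Inl (c x) \<in> cover" using in_cover element_at_unmatched vertex True by metis
      from vertex(1) True have "adj E x (c x)"
        by (cases rule: unmatched_cases) (use ex vertex z in auto)
      then show ?thesis using ex vertex by (intro bexI[of _ "Inl (c x)"]) (auto simp: adj_def)
    next
      case False
      have ex: "element_at x \<in> cover" using in_cover vertex by simp
      from vertex(1) False show ?thesis
      proof (cases rule: element_at_cases)
        case edge
        then show ?thesis using ex vertex by (intro bexI[of _ "Inr {x, m x}"]) auto
      next
        case self
        then show ?thesis using ex vertex z by auto
      next
        case other
        then show ?thesis using ex vertex mate(3)[OF vertex(1) False]
          by (intro bexI[of _ "Inl (m x)"]) (auto simp: adj_def)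
      qed
    qed
  next
    case (edge e)
    obtain x y where xy: "e = {x, y}" "adj E x y" using edge_adj[OF graph edge(1)] .
    then have yx: "e = {y, x}" "adj E y x" using adj_sym[of E x y] by (auto simp: insert_commute)
    show ?thesis
    proof (cases "m x = x")
      case True
      then have "m y \<noteq> y" using no_augmenting_path_1 xy by blast
      then show ?thesis using edge_dominated[OF yx(2)] edge yx(1) z by auto
    next
      case False
      then show ?thesis using edge_dominated[OF xy(2)] edge xy(1) z by auto
    qed
  qed
qed

end

section \<open>The vertex cover obtained from a total cover, and the lower bound\<close>

definition touched :: "('a + 'a set) set \<Rightarrow> 'a set" where
  "touched D = (\<Union>d\<in>D. case d of Inl v \<Rightarrow> {v} | Inr e \<Rightarrow> e)"

lemma touched_iff: "v \<in> touched D \<longleftrightarrow> Inl v \<in> D \<or> (\<exists>e. Inr e \<in> D \<and> v \<in> e)"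
proof -
  have "v \<in> (case d of Inl v \<Rightarrow> {v} | Inr e \<Rightarrow> e) \<longleftrightarrow> d = Inl v \<or> (\<exists>e. d = Inr e \<and> v \<in> e)" for d
    by (cases d) auto
  then show ?thesis by (auto simp: touched_def)
qed

lemma finite_total_cover:
  assumes "simple_graph V E" "total_cover V E D"
  shows "finite D"
proof -
  have "E \<subseteq> Pow V" "finite V" using assms(1) by (auto simp: simple_graph_def)
  then have "finite (V <+> E)" by (meson finite_Plus finite_Pow_iff finite_subset)
  then show ?thesis using assms(2) by (auto simp: total_cover_def intro: finite_subset)
qed

lemma card_touched:
  assumes "simple_graph V E" "total_cover V E D"
  shows "finite (touched D)" "card (touched D) \<le> 2 * card D"
proof -
  have fin: "finite D" using finite_total_cover[OF assms] .
  have el: "finite (case d of Inl v \<Rightarrow> {v} | Inr e \<Rightarrow> e) \<and>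
      card (case d of Inl v \<Rightarrow> {v} | Inr e \<Rightarrow> e) \<le> 2" if "d \<in> D" for d
  proof -
    have "e \<in> E \<Longrightarrow> finite e \<and> card e = 2" for e
      using assms(1) by (auto simp: simple_graph_def intro: finite_subset)
    then show ?thesis using that assms(2) by (auto simp: total_cover_def split: sum.split)
  qed
  show "finite (touched D)" using fin el by (auto simp: touched_def)
  have "card (touched D) \<le> (\<Sum>d\<in>D. card (case d of Inl v \<Rightarrow> {v} | Inr e \<Rightarrow> e))"
    unfolding touched_def by (rule card_UN_le[OF fin])
  also have "\<dots> \<le> of_nat (card D) * 2" by (rule sum_bounded_above) (use el in blast)
  finally show "card (touched D) \<le> 2 * card D" by simp
qed

lemma total_cover_dominates:
  assumes "total_cover V E D" "z \<in> V <+> E" "z \<notin> D"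
  obtains y where "y \<in> D" "adjacent_or_incident E z y"
  using assms by (auto simp only: total_cover_def Diff_iff)

text \<open>An element dominating an edge is one of its endpoints or an edge sharing an endpoint
  with it.\<close>

lemma touched_vertex_cover:
  assumes "total_cover V E D" "adj E u v"
  shows "u \<in> touched D \<or> v \<in> touched D"
proof (cases "Inr {u, v} \<in> D")
  case True
  then show ?thesis by (auto simp: touched_iff)
next
  case False
  moreover have "Inr {u, v} \<in> V <+> E" using assms(2) by (auto simp: adj_def)
  ultimately obtain y where "y \<in> D" "adjacent_or_incident E (Inr {u, v}) y"
    using total_cover_dominates[OF assms(1)] by blast
  then show ?thesis by (cases y) (auto simp: touched_iff)
qed

lemma touched_isolated:
  assumes "total_cover V E D" "v \<in> V" "\<And>u. \<not> adj E v u"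
  shows "v \<in> touched D"
proof (cases "Inl v \<in> D")
  case True
  then show ?thesis by (auto simp: touched_iff)
next
  case False
  then obtain y where y: "y \<in> D" "adjacent_or_incident E (Inl v) y"
    using total_cover_dominates[OF assms(1) InlI[OF assms(2)]] by blast
  then show ?thesis using assms(3) by (cases y) (auto simp: touched_iff adj_def)
qed

context selected_hubs
begin

text \<open>If \<open>X\<close> misses an unmatched vertex \<open>w\<close> without a hub, then all neighbours of
  \<open>w\<close> and their mates are in \<open>X\<close>, so that one endpoint of a matching edge in a triangle
  with \<open>w\<close> pays for \<open>w\<close> and the other one for the edge.\<close>

lemma card_cover_le_vertex_cover:
  assumes "finite X" and cov: "\<And>u v. adj E u v \<Longrightarrow> u \<in> X \<or> v \<in> X"
    and iso: "\<And>v. v \<in> V \<Longrightarrow> (\<And>u. \<not> adj E v u) \<Longrightarrow> v \<in> X"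
  shows "card cover \<le> card X"
proof -
  \<comment> \<open>\<open>r s x\<close> charges the cover element \<open>s\<close> to
    \<open>x\<close>: a vertex that pays for some unmatched \<open>w\<close> outside
    \<open>X\<close> is charged with \<open>w\<close>, any other with its own element. Fixing one
    neighbour \<open>f w\<close> lets only one endpoint of a triangle pay.\<close>
  define f where "f w = (SOME u. adj E w u)" for w
  define pays where "pays x w \<longleftrightarrow> w \<in> V \<and> m w = w \<and> c w = w \<and> w \<notin> X \<and> x = f w" for x w
  define r where "r s x \<longleftrightarrow> (if \<exists>w. pays x w then \<exists>w. pays x w \<and> s = Inl w else s = element_at x)"
    for s x
  have f: "adj E w (f w)" if "w \<in> V" "w \<notin> X" for w
    using iso[OF that(1)] that(2) someI_ex[of "adj E w"] unfolding f_def by blast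
  have pays: "adj E w x \<and> adj E w (m x) \<and> m w = w" if p: "pays x w" for x w
  proof -
    have "adj E w x" using p f by (auto simp: pays_def)
    moreover have "w \<in> V" "m w = w" "c w = w" using p by (simp_all add: pays_def)
    then have "adj E w (m x)"
    proof (cases rule: unmatched_cases)
      case self
      then show ?thesis using \<open>adj E w x\<close> by blast
    next
      case hub
      then show ?thesis using adj_in(3)[OF graph hub(1)] \<open>c w = w\<close> by simp
    qed
    moreover have "m w = w" using p by (simp add: pays_def)
    ultimately show ?thesis by blast
  qed
  have pays_unique: "w = w'" if "pays x w" "pays x w'" for x w w'
    using no_augmenting_path_3[of w' x w] pays[OF that(1)] pays[OF that(2)] adj_sym by metis
  have free: "\<exists>x'\<in>X. r (element_at x) x'" if x: "x \<in> X" "x \<in> V" "m x \<noteq> x" for x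
  proof (cases "\<exists>w. pays x w")
    case True
    then obtain w where w: "pays x w" by blast
    \<comment> \<open>Since \<open>x\<close> already pays for \<open>w\<close>, its matching edge is
      charged to the mate, which lies in \<open>X\<close> because \<open>w\<close> does not.\<close>
    have mx: "m x \<in> X" using cov[of w "m x"] pays[OF w] w by (simp add: pays_def)
    have "\<not> pays (m x) w'" for w'
    proof
      assume w': "pays (m x) w'"
      \<comment> \<open>After this both \<open>x\<close> and \<open>m x\<close> would be
        \<open>f w\<close>.\<close>
      have "w' = w"
        using no_augmenting_path_3[of w x w'] pays[OF w] pays[OF w'] adj_sym by metis
      then show False using w w' x by (auto simp: pays_def)
    qed
    then have "r (element_at x) (m x)" using element_at_mate[OF x(2)] by (simp add: r_def)
    then show ?thesis using mx by blast
  next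
    case False
    then show ?thesis using x by (auto simp: r_def)
  qed
  have matched: "\<exists>x'\<in>X. r (element_at x) x'" if x: "x \<in> V" "m x \<noteq> x" for x
  proof (cases "x \<in> X")
    case True
    then show ?thesis using free x by blast
  next
    case False
    then have "m x \<in> X" using cov mate(3) x by blast
    moreover have "m x \<in> V" "m (m x) \<noteq> m x" using mate x by auto
    ultimately show ?thesis using free[of "m x"] element_at_mate x by metis
  qed
  show ?thesis
  proof (rule card_le_if_inj_on_rel[where r = r])
    show "finite X" by fact
  next
    fix s assume "s \<in> cover"
    then obtain y where y: "y \<in> V" and s: "s = element_at y" by (auto simp: cover_def)
    have "\<exists>x\<in>X. r s x"
    proof (cases "m y = y")
      case False
      then show ?thesis using matched y s by blast
    next
      case True
      with y show ?thesis
      proof (cases rule: unmatched_cases)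
        case self
        have s': "s = Inl y" using s element_at_unmatched y True self by simp
        show ?thesis
        proof (cases "y \<in> X")
          case True
          \<comment> \<open>A paying vertex has an unmatched neighbour and is therefore
            matched.\<close>
          have "\<not> pays y w" for w
            using no_augmenting_path_1[of w y] pays[of y w] \<open>m y = y\<close> by blast
          then show ?thesis using True s by (auto simp: r_def)
        next
          case False
          then have "pays (f y) y" using True y self by (auto simp: pays_def)
          moreover have "f y \<in> X" using cov f[OF y False] False by blast
          ultimately show ?thesis using s' by (auto simp: r_def)
        qed
      next
        case hub
        \<comment> \<open>The hub \<open>c y\<close> yields the same element as \<open>y\<close>,
          which reduces to the matched case. The hub is fixed by \<open>c\<close>, as otherwise both
          ends of its matching edge would be selected.\<close>
        have u: "c y \<in> V" "m (c y) \<noteq> c y"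
          using adj_in[OF graph hub(1)] no_augmenting_path_1[OF hub(1) True] by auto
        have "c (c y) = c y"
        proof (rule ccontr)
          assume "c (c y) \<noteq> c y"
          then have "c (c y) = m (c y)" using u matched_cases by metis
          then show False using c_mate_of_selected[OF u] u hub by simp
        qed
        then have "s = element_at (c y)"
          using s element_at_unmatched y True hub by (simp add: element_at_def cover_element_def)
        then show ?thesis using matched u by blast
      qed
    qed
    then show "\<exists>x. x \<in> X \<and> r s x" by blast
  next
    fix s s' x assume "r s x" "r s' x"
    then show "s = s'" using pays_unique by (auto simp: r_def split: if_splits)
  qed
qed

lemma card_cover: "card cover \<le> 2 * alpha2 V E"
proof -
  \<comment> \<open>The minimum in \<open>alpha2\<close> is attained: there are finitely many total
    covers, and \<open>cover\<close> is one.\<close>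
  have "finite (V <+> E)"
    using graph by (auto simp: simple_graph_def intro: finite_subset[of E "Pow V"])
  then have "finite {D. total_cover V E D}"
    by (auto simp: total_cover_def intro: finite_subset[of _ "Pow (V <+> E)"])
  moreover have "{D. total_cover V E D} \<noteq> {}" using total_cover_cover by blast
  ultimately have "alpha2 V E \<in> card ` {D. total_cover V E D}"
    unfolding alpha2_def by (intro Min_in) auto
  then obtain D where D: "total_cover V E D" "alpha2 V E = card D" by auto
  have "card cover \<le> card (touched D)"
    using card_touched(1)[OF graph D(1)] touched_vertex_cover[OF D(1)]
      touched_isolated[OF D(1)] by (intro card_cover_le_vertex_cover) blast+
  then show ?thesis using card_touched(2)[OF graph D(1)] D(2) by simp
qed

end

section \<open>Timed Hoare triples\<close>

definition tri :: "(state \<Rightarrow> bool) \<Rightarrow> com \<Rightarrow> nat \<Rightarrow> (state \<Rightarrow> bool) \<Rightarrow> bool" where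
  "tri P c T Q \<longleftrightarrow> (\<forall>s. P s \<longrightarrow> (\<exists>t s'. exec c s t s' \<and> t \<le> T \<and> Q s'))"

fun modifies :: "com \<Rightarrow> vname set" where
  "modifies Skip = {}"
| "modifies (Assign x i a) = {x}"
| "modifies (Seq c d) = modifies c \<union> modifies d"
| "modifies (Cond b c d) = modifies c \<union> modifies d"
| "modifies (While b c) = modifies c"

lemma exec_modifies: "exec c s t s' \<Longrightarrow> x \<notin> modifies c \<Longrightarrow> s' x = s x"
  by (induction rule: exec.induct) auto

text \<open>\<open>run\<close> and \<open>ctime\<close> are meaningful for loop-free programs only.\<close>

fun run :: "com \<Rightarrow> state \<Rightarrow> state" where
  "run Skip s = s"
| "run (Assign x i a) s = s(x := (s x)(aval i s := aval a s))"
| "run (Seq c d) s = run d (run c s)"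
| "run (Cond b c d) s = (if bval b s then run c s else run d s)"
| "run (While b c) s = s"

fun loop_free :: "com \<Rightarrow> bool" where
  "loop_free (Seq c d) \<longleftrightarrow> loop_free c \<and> loop_free d"
| "loop_free (Cond b c d) \<longleftrightarrow> loop_free c \<and> loop_free d"
| "loop_free (While b c) \<longleftrightarrow> False"
| "loop_free _ \<longleftrightarrow> True"

fun ctime :: "com \<Rightarrow> nat" where
  "ctime Skip = 1"
| "ctime (Assign x i a) = 1 + atime i + atime a"
| "ctime (Seq c d) = ctime c + ctime d"
| "ctime (Cond b c d) = 1 + btime b + ctime c + ctime d"
| "ctime (While b c) = 0"

text \<open>\<open>ctime\<close> charges both branches of a \<open>Cond\<close>, so it bounds the
  time whatever the test yields.\<close>

lemma exec_loop_free: "loop_free c \<Longrightarrow> \<exists>t. exec c s t (run c s) \<and> t \<le> ctime c"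
proof (induction c arbitrary: s)
  case (Seq c d)
  then obtain t t' where "exec c s t (run c s)" "t \<le> ctime c"
    "exec d (run c s) t' (run d (run c s))" "t' \<le> ctime d"
    by force
  then show ?case by (auto intro!: exI[of _ "t + t'"] exec.Seq)
next
  case (Cond b c d)
  then obtain t t' where "exec c s t (run c s)" "t \<le> ctime c"
    "exec d s t' (run d s)" "t' \<le> ctime d"
    by force
  then show ?case
    by (cases "bval b s") (fastforce intro: exec.CondTrue exec.CondFalse)+
qed (auto intro: exec.intros)

lemma tri_loop_free:
  assumes "loop_free c" "\<And>s. P s \<Longrightarrow> Q (run c s)" "ctime c \<le> T"
  shows "tri P c T Q"
  using assms exec_loop_free[OF assms(1)] unfolding tri_def by (meson le_trans)

lemma tri_Seq:
  assumes "tri P c T Q" "tri Q d T' R"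
  shows "tri P (Seq c d) (T + T') R"
  using assms unfolding tri_def by (meson exec.Seq add_mono)

lemma tri_weaken:
  assumes "tri P c T Q" "\<And>s. P' s \<Longrightarrow> P s" "\<And>s. Q s \<Longrightarrow> Q' s" "T \<le> T'"
  shows "tri P' c T' Q'"
  using assms unfolding tri_def by (meson le_trans)

text \<open>Freezes the initial value of \<open>g\<close>, so that later states can be compared with
  it.\<close>

lemma tri_ghost:
  assumes "\<And>a. tri (\<lambda>s. P s \<and> g s = a) c T Q"
  shows "tri P c T Q"
  using assms unfolding tri_def by blast

definition For :: "vname \<Rightarrow> aexp \<Rightarrow> com \<Rightarrow> com" where
  "For x b c = Seq (Assign x (Const 0) (Const 0))
     (While (Less (Read x (Const 0)) b)
       (Seq c (Assign x (Const 0) (Plus (Read x (Const 0)) (Const 1)))))"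

text \<open>\<open>K\<close> bounds the rounds and \<open>T\<close> the body. If evaluating the loop
  bound costs at most 10, a test costs at most 14 and the increment 6; the extra round pays for the
  initialisation and the last test.\<close>

definition For_time :: "nat \<Rightarrow> nat \<Rightarrow> nat" where
  "For_time K T = (K + 1) * (T + 20)"

lemma modifies_For [simp]: "modifies (For x b c) = insert x (modifies c)"
  by (auto simp: For_def)

text \<open>Induction on the remaining rounds \<open>N - k\<close>. The invariant ignores cell 0 of
  \<open>x\<close>, so it survives reset and increment, and the body leaves the counter
  alone.\<close>

lemma tri_For:
  assumes body: "\<And>k. k < N \<Longrightarrow> tri (\<lambda>s. I k s \<and> s x 0 = k) c T (I (Suc k))"
    and counter: "\<And>k s v. I k s \<Longrightarrow> I k (s(x := (s x)(0 := v)))"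
    and bound: "\<And>k s. I k s \<Longrightarrow> aval b s = N" and time: "atime b \<le> 10" and N: "N \<le> K"
    and x: "x \<notin> modifies c"
  shows "tri (I 0) (For x b c) (For_time K T) (I N)"
proof -
  let ?test = "Less (Read x (Const 0)) b"
  let ?inc = "Assign x (Const 0) (Plus (Read x (Const 0)) (Const 1))"
  let ?W = "While ?test (Seq c ?inc)"
  have "\<exists>t s'. exec ?W s t s' \<and> t \<le> 15 + (N - k) * (T + 20) \<and> I N s'"
    if "I k s" "s x 0 = k" "k \<le> N" for k s
    using that
  proof (induction "N - k" arbitrary: k s)
    case 0
    then have "k = N" by simp
    then have "exec ?W s (1 + btime ?test) s" using bound[OF 0(2)] 0(3) by (intro exec.WhileFalse) simp
    moreover have "1 + btime ?test \<le> 15 + (N - k) * (T + 20)" using time by simp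
    ultimately show ?case using 0 \<open>k = N\<close> by blast
  next
    case (Suc d)
    then have k: "k < N" "d = N - Suc k" by auto
    obtain t1 s1 where s1: "exec c s t1 s1" "t1 \<le> T" "I (Suc k) s1"
      using body[OF k(1)] Suc(3,4) unfolding tri_def by blast
    have "s1 x 0 = k" using exec_modifies[OF s1(1) x] Suc(4) by simp
    define s2 where "s2 = s1(x := (s1 x)(0 := Suc k))"
    have s2: "exec ?inc s1 6 s2"
      using exec.Assign[of x "Const 0" "Plus (Read x (Const 0)) (Const 1)" s1] \<open>s1 x 0 = k\<close>
      by (simp add: s2_def eval_nat_numeral)
    have "I (Suc k) s2" using counter s1(3) by (simp add: s2_def)
    moreover have "s2 x 0 = Suc k" by (simp add: s2_def)
    ultimately obtain t3 s3 where s3: "exec ?W s2 t3 s3" "t3 \<le> 15 + (N - Suc k) * (T + 20)" "I N s3"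
      using Suc(1)[OF k(2) _ _ Suc_leI[OF k(1)]] by blast
    have "bval ?test s" using Suc(3,4) k bound by simp
    from exec.WhileTrue[OF this exec.Seq[OF s1(1) s2] s3(1)] have
      "exec ?W s (1 + btime ?test + (t1 + 6) + t3) s3" .
    moreover have "(N - k) * (T + 20) = T + 20 + (N - Suc k) * (T + 20)"
      using k by (simp flip: Suc_diff_Suc)
    then have "1 + btime ?test + (t1 + 6) + t3 \<le> 15 + (N - k) * (T + 20)"
      using s1(2) s3(2) time by simp
    ultimately show ?case using s3(3) by blast
  qed
  note W = this
  show ?thesis
    unfolding tri_def
  proof (intro allI impI)
    fix s assume "I 0 s"
    define s1 where "s1 = s(x := (s x)(0 := 0))"
    have s1: "exec (Assign x (Const 0) (Const 0)) s 3 s1"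
      using exec.Assign[of x "Const 0" "Const 0" s] by (simp add: s1_def eval_nat_numeral)
    have "I 0 s1" using counter \<open>I 0 s\<close> by (simp add: s1_def)
    moreover have "s1 x 0 = 0" by (simp add: s1_def)
    ultimately obtain t s2 where s2: "exec ?W s1 t s2" "t \<le> 15 + (N - 0) * (T + 20)" "I N s2"
      using W by blast
    have "N * (T + 20) \<le> K * (T + 20)" using N by simp
    then have "3 + t \<le> For_time K T" using s2(2) 
      unfolding For_time_def distrib_right[of K] diff_zero mult_1 by linarith
    then show "\<exists>t s'. exec (For x b c) s t s' \<and> t \<le> For_time K T \<and> I N s'"
      using exec.Seq[OF s1 s2(1)] s2(3) unfolding For_def by blast
  qed
qed


section \<open>The program\<close>

text \<open>The endpoints of arc number \<open>k\<close> are \<open>src[k]\<close> and \<open>dst[k]\<close>; every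
  edge gives two consecutive arcs, and \<open>q\<close> is the parity of \<open>i\<close>.\<close>

abbreviation "var x \<equiv> Read x (Const 0)"
abbreviation "vertex_count \<equiv> Read ''input'' (Const 1)"
text \<open>The input list is \<open>n\<close> followed by two endpoints per edge, so its length
  minus 1 is the number of arcs.\<close>

abbreviation "arc_count \<equiv> Minus (Read ''input'' (Const 0)) (Const 1)"
abbreviation "source x \<equiv> Read ''src'' (var x)"
abbreviation "target x \<equiv> Read ''dst'' (var x)"
abbreviation "mate_of a \<equiv> Read ''m'' a"

text \<open>Arc \<open>i\<close> starts at the endpoint in input cell \<open>i + 2\<close>; its
  other end is in the next cell for even \<open>i\<close> and in the previous one for odd
  \<open>i\<close>. The parity is tracked by a flag because the machine has no division.\<close>

definition store_arc :: com where
  "store_arc = Seq (Assign ''src'' (var ''i'') (Read ''input'' (Plus (var ''i'') (Const 2))))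
     (Cond (Eq (var ''q'') (Const 0))
       (Seq (Assign ''dst'' (var ''i'') (Read ''input'' (Plus (var ''i'') (Const 3))))
            (Assign ''q'' (Const 0) (Const 1)))
       (Seq (Assign ''dst'' (var ''i'') (Read ''input'' (Plus (var ''i'') (Const 1))))
            (Assign ''q'' (Const 0) (Const 0))))"

definition identity :: "vname \<Rightarrow> com" where
  "identity a = For ''x'' vertex_count (Assign a (var ''x'') (var ''x''))"

definition is_augmenting :: bexp where
  "is_augmenting =
     (let w = source ''i''; u = target ''i''; v = source ''j''; v' = target ''j'';
          u' = source ''k''; w' = target ''k''
      in And (And (Eq (mate_of w) w) (Eq (mate_of w') w'))
          (And (Not (Eq w w')) (And (And (Eq (mate_of u) v) (Eq (mate_of v') u'))
            (Not (And (Not (And (Not (Eq u v)) (Not (Eq v' u')))) (Not (And (Eq u w') (Eq v' w))))))))"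

text \<open>The operands are read from \<open>src\<close> and \<open>dst\<close> only, so successive
  assignments to \<open>m\<close> realise \<open>augment\<close>.\<close>

definition do_augment :: com where
  "do_augment =
     (let w = source ''i''; u = target ''i''; v = source ''j''; v' = target ''j'';
          u' = source ''k''; w' = target ''k''
      in Seq (Assign ''m'' v v') (Seq (Assign ''m'' v' v) (Seq (Assign ''m'' w u)
          (Seq (Assign ''m'' u w) (Seq (Assign ''m'' u' w') (Assign ''m'' w' u'))))))"

definition try_augment :: com where
  "try_augment = Cond is_augmenting do_augment Skip"

definition augment_pass :: com where
  "augment_pass = For ''i'' arc_count (For ''j'' arc_count (For ''k'' arc_count try_augment))"

text \<open>Adjacency is decided by scanning the arcs: \<open>bad\<close> records that the source of
  arc \<open>i\<close> is adjacent to the mate of its target, which is then no hub.\<close>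

definition check_arc :: com where
  "check_arc = Cond (And (Eq (source ''j'') (source ''i'')) (Eq (target ''j'') (mate_of (target ''i''))))
     (Assign ''bad'' (Const 0) (Const 1)) Skip"

definition select_hub :: com where
  "select_hub =
     Cond (And (Eq (mate_of (source ''i'')) (source ''i''))
            (And (Eq (Read ''c'' (source ''i'')) (source ''i'')) (Eq (var ''bad'') (Const 0))))
       (Seq (Assign ''c'' (source ''i'') (target ''i'')) (Assign ''c'' (mate_of (target ''i'')) (target ''i'')))
       Skip"

definition hub_step :: com where
  "hub_step = Seq (Assign ''bad'' (Const 0) (Const 0)) (Seq (For ''j'' arc_count check_arc) select_hub)"

text \<open>Both ends of a matching edge write the same element; repetition is harmless since the
  output encodes a set.\<close>

definition write_pair :: com where
  "write_pair =
     Seq (Assign ''output'' (Plus (Plus (var ''x'') (var ''x'')) (Const 1)) (Read ''c'' (var ''x'')))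
         (Assign ''output'' (Plus (Plus (var ''x'') (var ''x'')) (Const 2)) (Read ''c'' (mate_of (var ''x''))))"

definition write_length :: com where
  "write_length = Assign ''output'' (Const 0) (Plus vertex_count vertex_count)"

definition total_cover_program :: com where
  "total_cover_program =
     Seq (For ''i'' arc_count store_arc)
    (Seq (identity ''m'')
    (Seq (For ''p'' (Plus vertex_count (Const 1)) augment_pass)
    (Seq (identity ''c'')
    (Seq (For ''i'' arc_count hub_step)
    (Seq write_length
         (For ''x'' vertex_count write_pair))))))"

section \<open>The program on an encoded graph\<close>

lemma flatten_nth:
  "i < length es \<Longrightarrow> flatten es ! (2 * i) = fst (es ! i) \<and> flatten es ! Suc (2 * i) = snd (es ! i)"
  by (induction es arbitrary: i) (auto simp: flatten_def nth_Cons' less_Suc_eq_0_disj)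

lemma length_flatten: "length (flatten es) = 2 * length es"
  by (induction es) (auto simp: flatten_def)

locale encoded_graph =
  fixes n :: nat and es :: "(nat \<times> nat) list" and E :: "nat set set"
  assumes graph: "simple_graph {..<n} E"
    and E: "E = set (map (\<lambda>(u, v). {u, v}) es)"
    and distinct: "distinct (map (\<lambda>(u, v). {u, v}) es)"
begin

definition "arcs = 2 * length es"
definition "src k = flatten es ! k"
definition "dst k = flatten es ! (if even k then Suc k else k - 1)"
text \<open>A common bound on the rounds of all loops: \<open>n\<close>, \<open>n + 1\<close> and
  \<open>2 * length es\<close>.\<close>

definition "graph_size = 2 * (n + length es) + 1"

lemma card_E: "card E = length es"
  using distinct_card[OF distinct] E by simp

lemma adj_arc: "k < arcs \<Longrightarrow> adj E (src k) (dst k)"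
proof -
  assume "k < arcs"
  then obtain i where i: "i < length es" "k = 2 * i \<or> k = Suc (2 * i)"
    unfolding arcs_def by (metis Suc_lessD evenE mult_less_cancel1 oddE Suc_eq_plus1)
  then have "{fst (es ! i), snd (es ! i)} \<in> E"
    unfolding E by (auto intro!: image_eqI[of _ _ "es ! i"] split: prod.splits)
  then show ?thesis
    using i flatten_nth[OF i(1)] by (auto simp: src_def dst_def adj_def insert_commute)
qed

lemma arc_of_adj:
  assumes "adj E u v"
  obtains k where "k < arcs" "src k = u" "dst k = v"
proof -
  obtain i where i: "i < length es" "{u, v} = {fst (es ! i), snd (es ! i)}"
    using assms unfolding adj_def E by (auto simp: in_set_conv_nth split: prod.splits)
  then consider "u = fst (es ! i)" "v = snd (es ! i)" | "v = fst (es ! i)" "u = snd (es ! i)"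
    by (auto simp: doubleton_eq_iff)
  then show ?thesis
    by cases (use i flatten_nth[OF i(1)] that[of "2 * i"] that[of "Suc (2 * i)"] in
        \<open>auto simp: arcs_def src_def dst_def\<close>)
qed

lemma arc_less: "k < arcs \<Longrightarrow> src k < n" "k < arcs \<Longrightarrow> dst k < n"
  using adj_in[OF graph adj_arc] by auto

definition inp :: "state \<Rightarrow> bool" where
  "inp s \<longleftrightarrow> s ''input'' = input_state (n # flatten es) ''input''"

definition arcs_stored :: "state \<Rightarrow> bool" where
  "arcs_stored s \<longleftrightarrow> inp s \<and> (\<forall>k<arcs. s ''src'' k = src k \<and> s ''dst'' k = dst k)"

lemma inp_counts:
  assumes "inp s"
  shows "aval vertex_count s = n" "aval arc_count s = arcs"
  using assms by (simp_all add: inp_def input_state_def arcs_def length_flatten)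

lemma inp_arc: "inp s \<Longrightarrow> k < arcs \<Longrightarrow> s ''input'' (Suc (Suc k)) = flatten es ! k"
  by (simp add: inp_def input_state_def arcs_def length_flatten)

lemma counts_le: "n \<le> graph_size" "n + 1 \<le> graph_size" "arcs \<le> graph_size"
  by (auto simp: graph_size_def arcs_def)

lemma inp_upd [simp]: "x \<noteq> ''input'' \<Longrightarrow> inp (s(x := f)) = inp s"
  by (simp add: inp_def)

lemma arcs_stored_upd [simp]:
  "x \<notin> {''input'', ''src'', ''dst''} \<Longrightarrow> arcs_stored (s(x := f)) = arcs_stored s"
  by (auto simp: arcs_stored_def)

lemma tri_store_arcs:
  "tri (\<lambda>s. inp s \<and> s ''q'' 0 = 0) (For ''i'' arc_count store_arc)
     (For_time graph_size (ctime store_arc)) arcs_stored"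
proof -
  define I where "I k s \<longleftrightarrow> inp s \<and> s ''q'' 0 = k mod 2 \<and>
    (\<forall>l<k. s ''src'' l = src l \<and> s ''dst'' l = dst l)" for k and s :: state
  have "tri (I 0) (For ''i'' arc_count store_arc) (For_time graph_size (ctime store_arc)) (I arcs)"
  proof (rule tri_For[where I = I])
    fix k assume k: "k < arcs"
    show "tri (\<lambda>s. I k s \<and> s ''i'' 0 = k) store_arc (ctime store_arc) (I (Suc k))"
    proof (rule tri_loop_free)
      fix s assume s: "I k s \<and> s ''i'' 0 = k"
      note a = inp_arc[OF conjunct1[OF s[THEN conjunct1, unfolded I_def]]]
      have 1: "s ''input'' (k + 2) = src k" using a k by (simp add: src_def)
      have 2: "s ''input'' (k + 3) = dst k" if "even k"
      proof -
        \<comment> \<open>As \<open>arcs\<close> is even, an even index below it has its successor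
          below it too.\<close>
        have "Suc k < arcs" using that k by (auto simp: arcs_def elim!: evenE)
        from a[OF this] show ?thesis using that by (simp add: dst_def numeral_3_eq_3)
      qed
      have 3: "s ''input'' (k + 1) = dst k" if "odd k"
        using a[of "k - 1"] k that by (cases k) (auto simp: dst_def)
      show "I (Suc k) (run store_arc s)"
        using s 1 2 3 unfolding store_arc_def I_def
        by (cases "even k") (auto simp: less_Suc_eq mod_Suc even_iff_mod_2_eq_zero odd_iff_mod_2_eq_one)
    qed (simp_all add: store_arc_def)
  next
    fix k s assume "I k s"
    then show "aval arc_count s = arcs" using inp_counts unfolding I_def by blast
  qed (use counts_le in \<open>auto simp: I_def store_arc_def\<close>)
  then show ?thesis by (rule tri_weaken) (auto simp: I_def arcs_stored_def)
qed

lemma tri_identity: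
  assumes inv: "\<And>s f. R s \<Longrightarrow> R (s(''x'' := f))" "\<And>s f. R s \<Longrightarrow> R (s(a := f))" "\<And>s. R s \<Longrightarrow> inp s"
    and a: "a \<noteq> ''x''"
  shows "tri R (identity a) (For_time graph_size 5) (\<lambda>s. R s \<and> (\<forall>x<n. s a x = x))"
proof -
  define I where "I k s \<longleftrightarrow> R s \<and> (\<forall>x<k. s a x = x)" for k :: nat and s :: state
  have "tri (I 0) (identity a) (For_time graph_size 5) (I n)"
    unfolding identity_def
  proof (rule tri_For[where I = I])
    fix k
    show "tri (\<lambda>s. I k s \<and> s ''x'' 0 = k) (Assign a (var ''x'') (var ''x'')) 5 (I (Suc k))"
      by (rule tri_loop_free) (auto simp: I_def inv less_Suc_eq)
  next
    fix k s assume "I k s"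
    then show "aval vertex_count s = n" using inp_counts inv(3) unfolding I_def by blast
  qed (use a counts_le inv(1) in \<open>auto simp: I_def\<close>)
  then show ?thesis by (rule tri_weaken) (auto simp: I_def)
qed

section \<open>Search for augmenting paths\<close>

definition augmenting_arcs :: "(nat \<Rightarrow> nat) \<Rightarrow> nat \<Rightarrow> nat \<Rightarrow> nat \<Rightarrow> bool" where
  "augmenting_arcs m i j k = augmenting m (src i) (dst i) (src j) (dst j) (src k) (dst k)"

lemma locally_maximum_arcs:
  "locally_maximum E m \<longleftrightarrow> (\<forall>i<arcs. \<forall>j<arcs. \<forall>k<arcs. \<not> augmenting_arcs m i j k)"
  unfolding locally_maximum_def augmenting_arcs_def
  using adj_arc by (metis arc_of_adj)

text \<open>Here \<open>m\<close> is the matching at the start of the pass and \<open>A\<close> what the search has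
  established so far. The conjunct on \<open>locally_maximum\<close> makes later passes preserve a matching
  that is already locally maximum.\<close>

definition searched :: "(nat \<Rightarrow> nat) \<Rightarrow> bool \<Rightarrow> state \<Rightarrow> bool" where
  "searched m A s \<longleftrightarrow> arcs_stored s \<and> matching {..<n} E (s ''m'') \<and>
     (matched_count {..<n} m < matched_count {..<n} (s ''m'') \<and> \<not> locally_maximum E m \<or>
      s ''m'' = m \<and> A)"

lemma searched_upd [simp]:
  "x \<notin> {''input'', ''src'', ''dst'', ''m''} \<Longrightarrow> searched m A (s(x := f)) = searched m A s"
  by (auto simp: searched_def)

lemma searched_arc_count: "searched m A s \<Longrightarrow> aval arc_count s = arcs"
  using inp_counts unfolding searched_def arcs_stored_def by blast

text \<open>While the matching is still \<open>m\<close>, a failed test excludes one more triple.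
  The first successful test refutes local maximality of \<open>m\<close>, and every successful one
  raises the matched count.\<close>

lemma tri_try_augment:
  assumes "i < arcs" "j < arcs" "k < arcs"
  shows "tri (\<lambda>s. (searched m A s \<and> s ''i'' 0 = i \<and> s ''j'' 0 = j) \<and> s ''k'' 0 = k)
    try_augment (ctime try_augment)
    (\<lambda>s. searched m (A \<and> \<not> augmenting_arcs m i j k) s \<and> s ''i'' 0 = i \<and> s ''j'' 0 = j)"
proof (rule tri_loop_free)
  fix s assume s: "(searched m A s \<and> s ''i'' 0 = i \<and> s ''j'' 0 = j) \<and> s ''k'' 0 = k"
  let ?m = "s ''m''"
  let ?m' = "augment ?m (src i) (dst i) (src j) (dst j) (src k) (dst k)"
  have a: "s ''src'' l = src l \<and> s ''dst'' l = dst l" if "l < arcs" for l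
    using s that by (auto simp: searched_def arcs_stored_def)
  have test: "bval is_augmenting s \<longleftrightarrow> augmenting_arcs ?m i j k"
    using s a[OF assms(1)] a[OF assms(2)] a[OF assms(3)]
    by (simp add: is_augmenting_def augmenting_arcs_def augmenting_def Let_def)
  have step: "run do_augment s = s(''m'' := ?m')"
    using s a[OF assms(1)] a[OF assms(2)] a[OF assms(3)]
    by (simp add: do_augment_def augment_def Let_def)
  show "searched m (A \<and> \<not> augmenting_arcs m i j k) (run try_augment s) \<and>
      run try_augment s ''i'' 0 = i \<and> run try_augment s ''j'' 0 = j"
  proof (cases "augmenting_arcs ?m i j k")
    case True
    have "matching {..<n} E ?m'" "matched_count {..<n} ?m < matched_count {..<n} ?m'"
      using matching_augment[OF graph _ adj_arc adj_arc adj_arc]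
        matched_count_augment[OF graph _ adj_arc adj_arc adj_arc] assms True s
      by (auto simp: augmenting_arcs_def searched_def)
    moreover have "run try_augment s = s(''m'' := ?m')"
      using True test step by (simp add: try_augment_def)
    moreover have "\<not> locally_maximum E ?m"
      using True assms locally_maximum_arcs by blast
    ultimately show ?thesis using s by (auto simp: searched_def)
  next
    case False
    then have "run try_augment s = s" using test by (simp add: try_augment_def)
    then show ?thesis using s False by (auto simp: searched_def)
  qed
qed (simp_all add: try_augment_def do_augment_def Let_def)

lemma modifies_try_augment: "modifies try_augment = {''m''}"
  by (simp add: try_augment_def do_augment_def Let_def)

lemma tri_augment_pass:
  "tri (searched m True) augment_pass
     (For_time graph_size (For_time graph_size (For_time graph_size (ctime try_augment))))
     (searched m (locally_maximum E m))"
proof -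
  \<comment> \<open>Invariants of the three nested loops; \<open>A\<close> carries the findings of
    the enclosing loops.\<close>
  define Ik where "Ik A i j k s \<longleftrightarrow>
    searched m (A \<and> (\<forall>k'<k. \<not> augmenting_arcs m i j k')) s \<and> s ''i'' 0 = i \<and> s ''j'' 0 = j"
    for A i j k s
  define Ij where "Ij A i j s \<longleftrightarrow>
    searched m (A \<and> (\<forall>j'<j. \<forall>k<arcs. \<not> augmenting_arcs m i j' k)) s \<and> s ''i'' 0 = i"
    for A i j s
  define Ii where "Ii i = searched m (\<forall>i'<i. \<forall>j<arcs. \<forall>k<arcs. \<not> augmenting_arcs m i' j k)" for i
  have k: "tri (Ik A i j 0) (For ''k'' arc_count try_augment)
      (For_time graph_size (ctime try_augment)) (Ik A i j arcs)"
    if "i < arcs" "j < arcs" for A i j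
  proof (rule tri_For[where I = "Ik A i j"])
    fix k assume "k < arcs"
    from tri_try_augment[OF that this, where A = "A \<and> (\<forall>k'<k. \<not> augmenting_arcs m i j k')"]
    show "tri (\<lambda>s. Ik A i j k s \<and> s ''k'' 0 = k) try_augment (ctime try_augment) (Ik A i j (Suc k))"
      unfolding Ik_def less_Suc_eq by (rule tri_weaken) (auto simp: searched_def)
  next
    fix k s assume "Ik A i j k s"
    then show "aval arc_count s = arcs" using searched_arc_count unfolding Ik_def by blast
  qed (use counts_le in \<open>auto simp: Ik_def modifies_try_augment\<close>)
  have j: "tri (Ij A i 0) (For ''j'' arc_count (For ''k'' arc_count try_augment))
      (For_time graph_size (For_time graph_size (ctime try_augment))) (Ij A i arcs)"
    if "i < arcs" for A i
  proof (rule tri_For[where I = "Ij A i"])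
    fix j assume "j < arcs"
    from k[OF that this, of "A \<and> (\<forall>j'<j. \<forall>k<arcs. \<not> augmenting_arcs m i j' k)"]
    show "tri (\<lambda>s. Ij A i j s \<and> s ''j'' 0 = j) (For ''k'' arc_count try_augment)
        (For_time graph_size (ctime try_augment)) (Ij A i (Suc j))"
      unfolding Ik_def Ij_def less_Suc_eq by (rule tri_weaken) (auto simp: searched_def)
  next
    fix j s assume "Ij A i j s"
    then show "aval arc_count s = arcs" using searched_arc_count unfolding Ij_def by blast
  qed (use counts_le in \<open>auto simp: Ij_def modifies_try_augment\<close>)
  have "tri (Ii 0) augment_pass
      (For_time graph_size (For_time graph_size (For_time graph_size (ctime try_augment)))) (Ii arcs)"
    unfolding augment_pass_def
  proof (rule tri_For[where I = Ii])
    fix i assume "i < arcs"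
    from j[OF this, of "\<forall>i'<i. \<forall>j<arcs. \<forall>k<arcs. \<not> augmenting_arcs m i' j k"]
    show "tri (\<lambda>s. Ii i s \<and> s ''i'' 0 = i) (For ''j'' arc_count (For ''k'' arc_count try_augment))
        (For_time graph_size (For_time graph_size (ctime try_augment))) (Ii (Suc i))"
      unfolding Ij_def Ii_def less_Suc_eq by (rule tri_weaken) (auto simp: searched_def)
  next
    fix i s assume "Ii i s"
    then show "aval arc_count s = arcs" using searched_arc_count unfolding Ii_def by blast
  qed (use counts_le in \<open>auto simp: Ii_def modifies_try_augment\<close>)
  then show ?thesis
    by (rule tri_weaken) (auto simp: Ii_def locally_maximum_arcs)
qed

definition matching_stored :: "state \<Rightarrow> bool" where
  "matching_stored s \<longleftrightarrow>
     arcs_stored s \<and> matching {..<n} E (s ''m'') \<and> locally_maximum E (s ''m'')"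

lemma matching_stored_upd [simp]:
  "x \<notin> {''input'', ''src'', ''dst'', ''m''} \<Longrightarrow> matching_stored (s(x := f)) = matching_stored s"
  by (auto simp: matching_stored_def)

lemma modifies_augment_pass: "modifies augment_pass = {''i'', ''j'', ''k'', ''m''}"
  by (auto simp: augment_pass_def modifies_try_augment)

text \<open>A pass starting from a matching that is not locally maximum raises the matched count, so
  after \<open>p\<close> passes the count is at least \<open>p\<close> or the matching is locally
  maximum. The count is at most \<open>n\<close>, so \<open>n + 1\<close> passes force the
  latter.\<close>

lemma tri_augment_passes:
  "tri (\<lambda>s. arcs_stored s \<and> (\<forall>x<n. s ''m'' x = x))
     (For ''p'' (Plus vertex_count (Const 1)) augment_pass)
     (For_time graph_size
       (For_time graph_size (For_time graph_size (For_time graph_size (ctime try_augment)))))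
     matching_stored"
proof -
  define I where "I p s \<longleftrightarrow> arcs_stored s \<and> matching {..<n} E (s ''m'') \<and>
    (p \<le> matched_count {..<n} (s ''m'') \<or> locally_maximum E (s ''m''))" for p s
  have "tri (I 0) (For ''p'' (Plus vertex_count (Const 1)) augment_pass)
     (For_time graph_size
       (For_time graph_size (For_time graph_size (For_time graph_size (ctime try_augment)))))
     (I (n + 1))"
  proof (rule tri_For[where I = I])
    fix p
    have "tri (\<lambda>s. (I p s \<and> s ''p'' 0 = p) \<and> s ''m'' = m) augment_pass
        (For_time graph_size (For_time graph_size (For_time graph_size (ctime try_augment)))) (I (Suc p))"
      for m
    proof (cases "p \<le> matched_count {..<n} m \<or> locally_maximum E m")
      case True
      from tri_augment_pass[of m] show ?thesis
        by (rule tri_weaken) (use True in \<open>auto simp: I_def searched_def\<close>)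
    next
      case False
      then show ?thesis unfolding tri_def by (auto simp: I_def)
    qed
    then show "tri (\<lambda>s. I p s \<and> s ''p'' 0 = p) augment_pass
        (For_time graph_size (For_time graph_size (For_time graph_size (ctime try_augment)))) (I (Suc p))"
      by (rule tri_ghost)
  next
    fix p s assume "I p s"
    then have "aval vertex_count s = n" using inp_counts unfolding I_def arcs_stored_def by blast
    then show "aval (Plus vertex_count (Const 1)) s = n + 1" by simp
  qed (use counts_le in \<open>auto simp: I_def modifies_augment_pass\<close>)
  moreover have "matched_count {..<n} m \<le> n" for m :: "nat \<Rightarrow> nat"
    using card_mono[of "{..<n}" "{x \<in> {..<n}. m x \<noteq> x}"] by (auto simp: matched_count_def)
  then have "\<not> n + 1 \<le> matched_count {..<n} m" for m :: "nat \<Rightarrow> nat"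
    by (metis Suc_eq_plus1 not_less_eq_eq)
  ultimately show ?thesis
    by (elim tri_weaken) (auto simp: I_def matching_stored_def matching_def)
qed

section \<open>Search for hubs\<close>

definition hubs_stored :: "nat \<Rightarrow> state \<Rightarrow> bool" where
  "hubs_stored i s \<longleftrightarrow> matching_stored s \<and>
     hub_selection {..<n} E (s ''m'') ((\<lambda>l. (src l, dst l)) ` {..<i}) (s ''c'')"

lemma hubs_stored_upd [simp]:
  "x \<notin> {''input'', ''src'', ''dst'', ''m'', ''c''} \<Longrightarrow> hubs_stored i (s(x := f)) = hubs_stored i s"
  by (auto simp: hubs_stored_def)

lemma hubs_stored_inp: "hubs_stored i s \<Longrightarrow> inp s"
  by (simp add: hubs_stored_def matching_stored_def arcs_stored_def)

lemma hubs_stored_arc: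
  "hubs_stored i s \<Longrightarrow> l < arcs \<Longrightarrow> s ''src'' l = src l \<and> s ''dst'' l = dst l"
  by (simp add: hubs_stored_def matching_stored_def arcs_stored_def)

lemma hubs_stored_locally_maximum:
  "hubs_stored i s \<Longrightarrow> locally_maximum_matching {..<n} E (s ''m'')"
  by (simp add: hubs_stored_def matching_stored_def locally_maximum_matching_def graph)

lemma run_select_hub:
  assumes i: "i < arcs" and hubs: "hubs_stored i s" and "s ''i'' 0 = i"
    and bad: "s ''bad'' 0 = 0 \<longleftrightarrow> \<not> adj E (src i) (s ''m'' (dst i))"
  shows "hubs_stored (Suc i) (run select_hub s)"
proof -
  interpret locally_maximum_matching "{..<n}" E "s ''m''"
    using hubs_stored_locally_maximum[OF hubs] .
  let ?m = "s ''m''" and ?c = "s ''c''" and ?w = "src i" and ?u = "dst i"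
  let ?I = "(\<lambda>l. (src l, dst l)) ` {..<i}"
  have h: "matching_stored s" "hub_selection {..<n} E ?m ?I ?c"
    using hubs by (auto simp: hubs_stored_def)
  have I: "(\<lambda>l. (src l, dst l)) ` {..<Suc i} = insert (?w, ?u) ?I"
    by (simp add: lessThan_Suc)
  note a = hubs_stored_arc[OF hubs i]
  show ?thesis
  proof (cases "?m ?w = ?w \<and> ?c ?w = ?w \<and> \<not> adj E ?w (?m ?u)")
    case True
    have "run select_hub s = s(''c'' := ?c(?w := ?u, ?m ?u := ?u))"
      using True a assms(3) bad by (simp add: select_hub_def)
    then show ?thesis
      using h hub_selection_select[OF h(2) _ _ adj_arc[OF i]] True unfolding hubs_stored_def I by simp
  next
    case False
    then have "run select_hub s = s" using a assms(3) bad by (auto simp: select_hub_def)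
    moreover have "hub_selection {..<n} E ?m (insert (?w, ?u) ?I) ?c"
      using False arc_less(1)[OF i] by (intro hub_selection_skip[OF h(2)]) auto
    ultimately show ?thesis using h unfolding hubs_stored_def I by simp
  qed
qed

lemma tri_hub_step:
  assumes i: "i < arcs"
  shows "tri (\<lambda>s. hubs_stored i s \<and> s ''i'' 0 = i) hub_step
    (3 + (For_time graph_size (ctime check_arc) + ctime select_hub)) (hubs_stored (Suc i))"
proof -
  define J where "J j s \<longleftrightarrow> hubs_stored i s \<and> s ''i'' 0 = i \<and>
    (s ''bad'' 0 = 0 \<longleftrightarrow> \<not> (\<exists>l<j. src l = src i \<and> dst l = s ''m'' (dst i)))" for j s
  have 1: "tri (\<lambda>s. hubs_stored i s \<and> s ''i'' 0 = i) (Assign ''bad'' (Const 0) (Const 0)) 3 (J 0)"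
    by (rule tri_loop_free) (auto simp: J_def)
  have 2: "tri (J 0) (For ''j'' arc_count check_arc) (For_time graph_size (ctime check_arc)) (J arcs)"
  proof (rule tri_For[where I = J])
    fix j assume j: "j < arcs"
    show "tri (\<lambda>s. J j s \<and> s ''j'' 0 = j) check_arc (ctime check_arc) (J (Suc j))"
    proof (rule tri_loop_free)
      fix s assume s: "J j s \<and> s ''j'' 0 = j"
      then have "s ''src'' i = src i" "s ''dst'' i = dst i" "s ''src'' j = src j" "s ''dst'' j = dst j"
        using hubs_stored_arc i j unfolding J_def by blast+
      then have "run check_arc s =
          (if src j = src i \<and> dst j = s ''m'' (dst i) then s(''bad'' := (s ''bad'')(0 := 1)) else s)"
        using s by (simp add: J_def check_arc_def)
      then show "J (Suc j) (run check_arc s)"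
        using s unfolding J_def less_Suc_eq by auto
    qed (simp_all add: check_arc_def)
  next
    fix j s assume "J j s"
    then show "aval arc_count s = arcs" using inp_counts hubs_stored_inp unfolding J_def by blast
  qed (use counts_le in \<open>auto simp: J_def check_arc_def\<close>)
  have 3: "tri (J arcs) select_hub (ctime select_hub) (hubs_stored (Suc i))"
  proof (rule tri_loop_free)
    fix s assume s: "J arcs s"
    have arc_iff: "(\<exists>l<arcs. src l = u \<and> dst l = v) \<longleftrightarrow> adj E u v" for u v
      using adj_arc arc_of_adj[of u v] by blast
    show "hubs_stored (Suc i) (run select_hub s)"
      using s by (intro run_select_hub[OF i]) (simp_all add: J_def arc_iff)
  qed (simp_all add: select_hub_def)
  show ?thesis unfolding hub_step_def using tri_Seq[OF 1 tri_Seq[OF 2 3]] .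
qed

lemma tri_hub_steps:
  "tri (\<lambda>s. matching_stored s \<and> (\<forall>x<n. s ''c'' x = x)) (For ''i'' arc_count hub_step)
     (For_time graph_size (3 + (For_time graph_size (ctime check_arc) + ctime select_hub)))
     (hubs_stored arcs)"
proof -
  have "tri (hubs_stored 0) (For ''i'' arc_count hub_step)
     (For_time graph_size (3 + (For_time graph_size (ctime check_arc) + ctime select_hub)))
     (hubs_stored arcs)"
  proof (rule tri_For[where I = hubs_stored])
    fix i s assume "hubs_stored i s"
    then show "aval arc_count s = arcs" using inp_counts hubs_stored_inp by blast
  qed (use tri_hub_step counts_le in \<open>auto simp: hub_step_def check_arc_def select_hub_def\<close>)
  then show ?thesis
    by (rule tri_weaken) (auto simp: hubs_stored_def hub_selection_def)
qed

section \<open>Output and correctness\<close>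

definition output_stored :: "nat \<Rightarrow> state \<Rightarrow> bool" where
  "output_stored k s \<longleftrightarrow> hubs_stored arcs s \<and> s ''output'' 0 = n + n \<and>
     (\<forall>x<k. s ''output'' (x + x + 1) = s ''c'' x \<and> s ''output'' (x + x + 2) = s ''c'' (s ''m'' x))"

lemma tri_write_length: "tri (hubs_stored arcs) write_length (ctime write_length) (output_stored 0)"
proof (rule tri_loop_free)
  fix s assume s: "hubs_stored arcs s"
  then show "output_stored 0 (run write_length s)"
    using inp_counts(1)[OF hubs_stored_inp[OF s]] by (simp add: output_stored_def write_length_def)
qed (simp_all add: write_length_def)

lemma tri_write_pairs:
  "tri (output_stored 0) (For ''x'' vertex_count write_pair) (For_time graph_size (ctime write_pair))
     (output_stored n)"
proof (rule tri_For[where I = output_stored])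
  fix k
  \<comment> \<open>The cells of different vertices are disjoint, so earlier pairs are not
    overwritten.\<close>
  have ne: "x + x + 1 \<noteq> k + k + 1 \<and> x + x + 1 \<noteq> k + k + 2 \<and> x + x + 2 \<noteq> k + k + 1 \<and>
      x + x + 2 \<noteq> k + k + 2" if "x < k" for x :: nat
    using that by presburger
  show "tri (\<lambda>s. output_stored k s \<and> s ''x'' 0 = k) write_pair (ctime write_pair) (output_stored (Suc k))"
    by (rule tri_loop_free) (use ne in \<open>auto simp: output_stored_def write_pair_def less_Suc_eq\<close>)
next
  fix k s assume "output_stored k s"
  then show "aval vertex_count s = n"
    using inp_counts hubs_stored_inp unfolding output_stored_def by blast
qed (use counts_le in \<open>auto simp: output_stored_def write_pair_def\<close>)

lemma tri_total_cover_program: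
  "tri (\<lambda>s. inp s \<and> s ''q'' 0 = 0) total_cover_program
    (For_time graph_size (ctime store_arc) + (For_time graph_size 5 +
     (For_time graph_size
       (For_time graph_size (For_time graph_size (For_time graph_size (ctime try_augment)))) +
      (For_time graph_size 5 +
       (For_time graph_size (3 + (For_time graph_size (ctime check_arc) + ctime select_hub)) +
        (ctime write_length + For_time graph_size (ctime write_pair))))))) (output_stored n)"
  unfolding total_cover_program_def
proof (intro tri_Seq)
  show "tri arcs_stored (identity ''m'') (For_time graph_size 5)
      (\<lambda>s. arcs_stored s \<and> (\<forall>x<n. s ''m'' x = x))"
    by (rule tri_identity) (auto simp: arcs_stored_def)
  show "tri matching_stored (identity ''c'') (For_time graph_size 5)
      (\<lambda>s. matching_stored s \<and> (\<forall>x<n. s ''c'' x = x))"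
    by (rule tri_identity) (auto simp: matching_stored_def arcs_stored_def)
qed (fact tri_store_arcs tri_augment_passes tri_hub_steps tri_write_length tri_write_pairs)+

lemma output_list_stored:
  assumes "output_stored n s"
  shows "output_list s = flatten (map (\<lambda>x. (s ''c'' x, s ''c'' (s ''m'' x))) [0..<n])"
proof -
  have "map (s ''output'') [1..<Suc (k + k)] = flatten (map (\<lambda>x. (s ''c'' x, s ''c'' (s ''m'' x))) [0..<k])"
    if "k \<le> n" for k
    using that
  proof (induction k)
    case (Suc k)
    then show ?case using assms by (simp add: output_stored_def flatten_def)
  qed (simp add: flatten_def)
  then show ?thesis using assms by (simp add: output_list_def output_stored_def)
qed

lemma output_stored_cover:
  assumes "output_stored n s"
  shows "\<exists>S. encodes_elements (output_list s) S \<and> total_cover {..<n} E S \<and> card S \<le> 2 * alpha2 {..<n} E"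
proof -
  let ?m = "s ''m''" and ?c = "s ''c''"
  have hubs: "hubs_stored arcs s" using assms by (simp add: output_stored_def)
  \<comment> \<open>The arcs exhaust the adjacency relation, so every possible hub has been
    examined.\<close>
  have "(\<lambda>l. (src l, dst l)) ` {..<arcs} = {(x, y). adj E x y}"
  proof (intro equalityI subsetI)
    fix p assume "p \<in> {(x, y). adj E x y}"
    then obtain l where "l < arcs" "p = (src l, dst l)"
      using arc_of_adj[of "fst p" "snd p"] by (metis case_prod_unfold mem_Collect_eq prod.collapse)
    then show "p \<in> (\<lambda>l. (src l, dst l)) ` {..<arcs}" by blast
  qed (use adj_arc in auto)
  then have "selected_hubs {..<n} E ?m ?c"
    using hubs hubs_stored_locally_maximum[OF hubs]
    by (simp add: selected_hubs_def selected_hubs_axioms_def hubs_stored_def)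
  then interpret selected_hubs "{..<n}" E ?m ?c .
  have "cover = element_of_pair ` set (map (\<lambda>x. (?c x, ?c (?m x))) [0..<n])"
    unfolding cover_def list.set_map image_image set_upt atLeast0LessThan
    by (simp add: element_at_def cover_element_def element_of_pair_def)
  then have "encodes_elements (output_list s) cover"
    unfolding encodes_elements_def output_list_stored[OF assms] by blast
  then show ?thesis using total_cover_cover card_cover by blast
qed

end

text \<open>\<open>For_time\<close> as a polynomial in the number of vertices and edges, for loops of at most
  \<open>graph_size\<close> rounds.\<close>

definition For_poly :: "nat poly \<Rightarrow> nat poly" where
  "For_poly p = [:2, 2:] * (p + [:20:])"

text \<open>Mirrors the bound in \<open>tri_total_cover_program\<close>. The coefficients depend on
  the program text alone, so one polynomial serves all graphs.\<close>

definition time_poly :: "nat poly" where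
  "time_poly =
     For_poly [:ctime store_arc:] + (For_poly [:5:] +
     (For_poly (For_poly (For_poly (For_poly [:ctime try_augment:]))) +
      (For_poly [:5:] +
       (For_poly ([:3:] + (For_poly [:ctime check_arc:] + [:ctime select_hub:])) +
        ([:ctime write_length:] + For_poly [:ctime write_pair:])))))"

lemma poly_const: "poly [:a:] x = a"
  by simp

text \<open>For \<open>x = n + length es\<close>, the loop bound \<open>K = 2 * x + 1\<close> gives
  the factor \<open>K + 1 = 2 + 2 * x\<close>.\<close>

lemma (in encoded_graph) poly_For_poly:
  "poly (For_poly p) (n + length es) = For_time graph_size (poly p (n + length es))"
  by (simp add: For_poly_def For_time_def graph_size_def algebra_simps)

theorem theorem1:
  "\<exists>(c :: com) (p :: nat poly).
     \<forall>(V :: nat set) (E :: nat set set) (xs :: nat list).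
       simple_graph V E \<and> encodes_graph xs V E \<longrightarrow>
         (\<exists>t s. exec c (input_state xs) t s \<and>
            t \<le> poly p (card V + card E) \<and>
            (\<exists>S. encodes_elements (output_list s) S \<and>
                 total_cover V E S \<and> card S \<le> 2 * alpha2 V E))"
proof (intro exI[of _ total_cover_program] exI[of _ time_poly] allI impI)
  fix V :: "nat set" and E xs
  assume asm: "simple_graph V E \<and> encodes_graph xs V E"
  then obtain n es where xs: "xs = n # flatten es" and V: "V = {..<n}"
    and es: "distinct (map (\<lambda>(u, v). {u, v}) es)" "E = set (map (\<lambda>(u, v). {u, v}) es)"
    unfolding encodes_graph_def by blast
  interpret encoded_graph n es E
    using asm V es by unfold_locales auto
  have "inp (input_state xs) \<and> input_state xs ''q'' 0 = 0"
    by (simp add: inp_def xs) (simp add: input_state_def)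
  then obtain t s where ts: "exec total_cover_program (input_state xs) t s" "output_stored n s"
    "t \<le> poly time_poly (n + length es)"
    using tri_total_cover_program[unfolded tri_def, rule_format, of "input_state xs"]
    unfolding time_poly_def poly_add poly_For_poly poly_const by blast
  have card: "card V + card E = n + length es" by (simp add: card_E V)
  show "\<exists>t s. exec total_cover_program (input_state xs) t s \<and>
      t \<le> poly time_poly (card V + card E) \<and>
      (\<exists>S. encodes_elements (output_list s) S \<and> total_cover V E S \<and> card S \<le> 2 * alpha2 V E)"
    unfolding card unfolding V using ts(1,3) output_stored_cover[OF ts(2)] by blast
qed

end
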